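(* Let $f(z)=\sum_{k=1}^N c_{\alpha_k}z^{\alpha_k}$ be a Laurent polynomial in $n$ variables with support $A=\{\alpha_1,\dots,\alpha_N\}\subset\mathbb{Z}^n$, whose Newton polytope has dimension $n$, and let $B$ be a dual matrix of $A$. If $g_A=1$, i.e. if the maximal minors of the matrix $A$ are relatively prime, then the order map \[ \operatorname{co-ord}\colon \operatorname{CC}(\overline{\mathcal{LA}'}(f)) \rightarrow \operatorname{int}(\mathcal{Z}_B)\cap\big(\operatorname{Arg}_\pi(c)B+2\pi\mathbb{Z}[B]\big) \] is an injection.
   Context: All coefficients $c_{\alpha_k}$ are nonzero complex numbers, the $\alpha_k$ are distinct, and $\mathbf{T}^n=(\mathbb{R}/2\pi\mathbb{Z})^n$. A half-space is a set $H_\phi=\{z\in\mathbb{C}\mid \Re(e^{i\phi}z)>0\}$, $\phi\in\mathbb{R}$. For $\theta\in\mathbf{T}^n$ put $f\langle\theta\rangle=[e^{i(\arg(c_{\alpha_1})+\langle\alpha_1,\theta\rangle)},\dots,e^{i(\arg(c_{\alpha_N})+\langle\alpha_N,\theta\rangle)}]$, also viewed as a subset of the unit circle. It is lopsided if there is a half-space $H$ with $f\langle\theta\rangle\subset\overline{H}$ but $f\langle\theta\rangle\not\subset\partial H$. The lopsided coamoeba $\mathcal{LA}'(f)$ is the set of $\theta\in\mathbf{T}^n$ such that $f\langle\theta\rangle$ is not lopsided; $\overline{\mathcal{LA}'}(f)$ is its closure, and $\operatorname{CC}(\overline{\mathcal{LA}'}(f))$ is the set of connected components of the complement of $\overline{\mathcal{LA}'}(f)$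 in $\mathbf{T}^n$. The Newton polytope of $f$ is $\Delta_f=\operatorname{Conv}(A)$. Identify $A$ with the $(n+1)\times N$ integer matrix whose $k$th column is $(1,\alpha_k)^t$; $g_A$ denotes the greatest common divisor of its maximal, i.e. $(n+1)\times(n+1)$, minors. Set $m=N-n-1$. A dual matrix of $A$ is an integer $N\times m$ matrix $B$ of full rank $m$ with $AB=0$; denote its rows by $b_1,\dots,b_N\in\mathbb{Z}^m$. $\mathbb{Z}[B]\subset\mathbb{Z}^m$ is the lattice generated by the rows of $B$, and $\mathcal{Z}_B=\{\sum_{j=1}^N\frac{\pi}{2}\mu_jb_j\mid |\mu_j|\le 1\}\subset\mathbb{R}^m$. $\arg_\pi\colon\mathbb{C}^*\to(-\pi,\pi]$ is the principal argument, and $\operatorname{Arg}_\pi(c)=(\arg_\pi(c_{\alpha_1}),\dots,\arg_\pi(c_{\alpha_N}))$, a row vector. For $\alpha\in A$ and $\theta\in\mathbb{R}^n$ set \[ p_\alpha^k(\theta)=\arg_\pi\Big(\frac{c_{\alpha_k}e^{i\langle\alpha_k,\theta\rangle}}{c_\alpha e^{i\langle\alpha,\theta\rangle}}\Big)-\arg_\pi(c_{\alpha_k})+\arg_\pi(c_\alpha)-\langle\alpha_k-\alpha,\theta\rangle, \] $p_\alpha(\theta)=(p_\alpha^1(\theta),\dots,p_\alpha^N(\theta))$, and $v_\alpha(\theta)=(\operatorname{Arg}_\pi(c)+p_\alpha(\theta))B\in\mathbb{R}^m$ ($2\pi$-periodic in each $\theta_i$). The order map is defined by $\operatorname{co-ord}(\Theta)=v_\alpha(\theta)$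 for any $\theta\in\Theta$ and any $\alpha\in A$; this is independent of the choices of $\theta$ and $\alpha$ and takes values in the stated target set. *)

theory Defs
  imports "HOL-Analysis.Analysis"
begin

quotient_type angle = real / "\<lambda>x y. \<exists>k::int. x - y = 2 * pi * of_int k"
proof (rule equivpI)
  show "reflp (\<lambda>x y. \<exists>k::int. x - y = 2 * pi * of_int k)"
    by (rule reflpI) (rule exI[of _ 0], simp)
  show "symp (\<lambda>x y. \<exists>k::int. x - y = 2 * pi * of_int k)"
  proof (rule sympI, elim exE)
    fix x y :: real and k :: int
    assume "x - y = 2 * pi * of_int k"
    then have "y - x = 2 * pi * of_int (- k)" by simp
    then show "\<exists>k::int. y - x = 2 * pi * of_int k" ..
  qed
  show "transp (\<lambda>x y. \<exists>k::int. x - y = 2 * pi * of_int k)"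
  proof (rule transpI, elim exE)
    fix x y z :: real and k l :: int
    assume "x - y = 2 * pi * of_int k" "y - z = 2 * pi * of_int l"
    then have "x - z = 2 * pi * of_int (k + l)" by (simp add: algebra_simps)
    then show "\<exists>k::int. x - z = 2 * pi * of_int k" ..
  qed
qed

instantiation angle :: topological_space
begin

definition open_angle :: "angle set \<Rightarrow> bool" where
  "open_angle U \<longleftrightarrow> open (abs_angle -` U)"

instance
proof
  show "open (UNIV :: angle set)"
    by (simp add: open_angle_def)
  show "open (S \<inter> T)" if "open S" "open T" for S T :: "angle set"
    using that by (simp add: open_angle_def open_Int vimage_Int)
  show "open (\<Union> K)" if "\<forall>S\<in>K. open S" for K :: "angle set set"
    using that by (auto simp add: open_angle_def vimage_Union)
qed

end

type_synonym 'n torus = "angle ^ 'n"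

definition to_torus :: "real ^ 'n \<Rightarrow> 'n::finite torus" where
  "to_torus \<theta> = (\<chi> i. abs_angle (\<theta> $ i))"

text \<open>
  A Laurent polynomial \<open>f(z) = \<Sum>k. c k * z^(\<alpha> k)\<close> in \<open>CARD('n)\<close> variables with \<open>CARD('N)\<close> terms
  is given by its coefficients \<open>c :: 'N \<Rightarrow> complex\<close> and its exponents \<open>\<alpha> :: 'N \<Rightarrow> int ^ 'n\<close>.
\<close>

definition real_vec :: "int ^ 'n \<Rightarrow> real ^ 'n::finite" where
  "real_vec a = (\<chi> i. real_of_int (a $ i))"

definition newton_polytope :: "('N::finite \<Rightarrow> int ^ 'n) \<Rightarrow> (real ^ 'n::finite) set" where
  "newton_polytope \<alpha> = convex hull (range (\<lambda>k. real_vec (\<alpha> k)))"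

definition half_space :: "real \<Rightarrow> complex set" where
  "half_space \<phi> = {z. Re (cis \<phi> * z) > 0}"

definition phases ::
    "('N::finite \<Rightarrow> complex) \<Rightarrow> ('N \<Rightarrow> int ^ 'n) \<Rightarrow> real ^ 'n::finite \<Rightarrow> 'N \<Rightarrow> complex" where
  "phases c \<alpha> \<theta> k = cis (Arg (c k) + real_vec (\<alpha> k) \<bullet> \<theta>)"

definition lopsided ::
    "('N::finite \<Rightarrow> complex) \<Rightarrow> ('N \<Rightarrow> int ^ 'n) \<Rightarrow> real ^ 'n::finite \<Rightarrow> bool" where
  "lopsided c \<alpha> \<theta> \<longleftrightarrow>
     (\<exists>\<phi>. range (phases c \<alpha> \<theta>) \<subseteq> closure (half_space \<phi>) \<and>
          \<not> range (phases c \<alpha> \<theta>) \<subseteq> frontier (half_space \<phi>))"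

text \<open>Lopsidedness is \<open>2\<pi>\<close>-periodic in each coordinate, so the choice of representatives does not
  matter.\<close>

definition lopsided_coamoeba ::
    "('N::finite \<Rightarrow> complex) \<Rightarrow> ('N \<Rightarrow> int ^ 'n) \<Rightarrow> ('n::finite torus) set" where
  "lopsided_coamoeba c \<alpha> = to_torus ` {\<theta>. \<not> lopsided c \<alpha> \<theta>}"

definition CC ::
    "('N::finite \<Rightarrow> complex) \<Rightarrow> ('N \<Rightarrow> int ^ 'n) \<Rightarrow> ('n::finite torus) set set" where
  "CC c \<alpha> = components (- closure (lopsided_coamoeba c \<alpha>))"

text \<open>The columns are \<open>(1, \<alpha> k)\<close>; the row of ones has index \<open>None\<close>.\<close>

definition exponent_matrix :: "('N::finite \<Rightarrow> int ^ 'n) \<Rightarrow> int ^ 'N ^ ('n::finite option)" where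
  "exponent_matrix \<alpha> = (\<chi> r k. case r of None \<Rightarrow> 1 | Some i \<Rightarrow> \<alpha> k $ i)"

text \<open>A maximal minor is given by an injective choice \<open>\<sigma>\<close> of columns. Each minor occurs with all
  orderings of its columns, which only affects its sign and not the greatest common divisor.\<close>

definition gcd_maximal_minors :: "int ^ 'N::finite ^ 'r::finite \<Rightarrow> int" where
  "gcd_maximal_minors M = Gcd {det (\<chi> r s. M $ r $ \<sigma> s) | \<sigma> :: 'r \<Rightarrow> 'N. inj \<sigma>}"

text \<open>
  Since \<open>m = 0\<close> is possible, \<open>m\<close> is a number and not an index type. Vectors in \<open>\<real>\<^sup>m\<close> are
  sequences vanishing from index \<open>m\<close> on, as in \<^const>\<open>Euclidean_space\<close>. An \<open>N\<times>m\<close> matrix is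
  the function \<open>B\<close> taking \<open>k\<close> to its row \<open>B k\<close>.
\<close>

definition dual_matrix ::
    "nat \<Rightarrow> int ^ 'N ^ 'r \<Rightarrow> ('N \<Rightarrow> nat \<Rightarrow> int) \<Rightarrow> bool" where
  "dual_matrix m M B \<longleftrightarrow>
     (\<forall>k j. m \<le> j \<longrightarrow> B k j = 0) \<and>
     dim ((\<lambda>j. (\<chi> k. real_of_int (B k j)) :: real ^ 'N::finite) ` {..<m}) = m \<and>
     (\<forall>(r::'r::finite) j. (\<Sum>k\<in>UNIV. M $ r $ k * B k j) = 0)"

definition row_times :: "real ^ 'N::finite \<Rightarrow> ('N \<Rightarrow> nat \<Rightarrow> int) \<Rightarrow> nat \<Rightarrow> real" where
  "row_times x B = (\<lambda>j. \<Sum>k\<in>UNIV. x $ k * real_of_int (B k j))"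

definition row_lattice :: "('N::finite \<Rightarrow> nat \<Rightarrow> int) \<Rightarrow> (nat \<Rightarrow> int) set" where
  "row_lattice B = {(\<lambda>j. \<Sum>k\<in>UNIV. z k * B k j) | z :: 'N \<Rightarrow> int. True}"

definition zonotope :: "('N::finite \<Rightarrow> nat \<Rightarrow> int) \<Rightarrow> (nat \<Rightarrow> real) set" where
  "zonotope B = {(\<lambda>j. \<Sum>k\<in>UNIV. pi / 2 * \<mu> k * real_of_int (B k j)) | \<mu>. \<forall>k. \<bar>\<mu> k\<bar> \<le> 1}"

definition Arg_vec :: "('N::finite \<Rightarrow> complex) \<Rightarrow> real ^ 'N" where
  "Arg_vec c = (\<chi> k. Arg (c k))"

text \<open>The index \<open>l\<close> stands for the exponent \<open>\<alpha> l\<close>.\<close>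

definition p_vec ::
    "('N::finite \<Rightarrow> complex) \<Rightarrow> ('N \<Rightarrow> int ^ 'n) \<Rightarrow> 'N \<Rightarrow> real ^ 'n::finite \<Rightarrow> real ^ 'N" where
  "p_vec c \<alpha> l \<theta> = (\<chi> k.
     Arg ((c k * cis (real_vec (\<alpha> k) \<bullet> \<theta>)) / (c l * cis (real_vec (\<alpha> l) \<bullet> \<theta>)))
     - Arg (c k) + Arg (c l) - real_vec (\<alpha> k - \<alpha> l) \<bullet> \<theta>)"

definition v_vec ::
    "('N::finite \<Rightarrow> complex) \<Rightarrow> ('N \<Rightarrow> int ^ 'n) \<Rightarrow> ('N \<Rightarrow> nat \<Rightarrow> int) \<Rightarrow> 'N \<Rightarrow>
     real ^ 'n::finite \<Rightarrow> nat \<Rightarrow> real" where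
  "v_vec c \<alpha> B l \<theta> = row_times (Arg_vec c + p_vec c \<alpha> l \<theta>) B"

text \<open>The common value of \<^const>\<open>v_vec\<close> over all representatives of points of \<open>\<Theta>\<close> and all \<open>l\<close>.\<close>

definition co_ord ::
    "('N::finite \<Rightarrow> complex) \<Rightarrow> ('N \<Rightarrow> int ^ 'n) \<Rightarrow> ('N \<Rightarrow> nat \<Rightarrow> int) \<Rightarrow>
     ('n::finite torus) set \<Rightarrow> nat \<Rightarrow> real" where
  "co_ord c \<alpha> B \<Theta> = (THE v. \<forall>\<theta> l. to_torus \<theta> \<in> \<Theta> \<longrightarrow> v_vec c \<alpha> B l \<theta> = v)"

definition co_ord_target ::
    "nat \<Rightarrow> ('N::finite \<Rightarrow> complex) \<Rightarrow> ('N \<Rightarrow> nat \<Rightarrow> int) \<Rightarrow> (nat \<Rightarrow> real) set" where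
  "co_ord_target m c B =
     (Euclidean_space m interior_of zonotope B) \<inter>
     {(\<lambda>j. row_times (Arg_vec c) B j + 2 * pi * real_of_int (w j)) | w. w \<in> row_lattice B}"

end

theory Submission
  imports Defs
begin

text \<open>
  Since the exponents are distinct, the complement of the closed lopsided coamoeba consists of the
  points whose phases lie in an open half-plane. Lifted to \<open>\<real>\<^sup>n\<close>, it is the union over
  \<open>z \<in> \<int>\<^sup>N\<close> of the open convex sets of those \<open>\<theta>\<close> for which the numbers
  \<open>Arg c\<^sub>k + \<langle>\<alpha>\<^sub>k, \<theta>\<rangle> + 2\<pi> z\<^sub>k\<close> lie in an open interval of length \<open>\<pi>\<close>. On such a
  cell the order map has the value \<open>Arg(c)B + 2\<pi> zB\<close>, so it is locally constant. If two cells have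
  the same value, the difference of their indices lies in the left kernel of \<open>B\<close>. Because
  \<open>g\<^sub>A = 1\<close>, this kernel in \<open>\<int>\<^sup>N\<close> is the integer row space of \<open>A\<close>, and shifting \<open>z\<close> by an
  integer combination of the rows of \<open>A\<close> translates the cell by a vector of \<open>2\<pi>\<int>\<^sup>n\<close>. Hence both
  cells have the same connected image in the torus.
\<close>

section \<open>The torus\<close>

lemma continuous_abs_angle: "continuous_on S abs_angle"
  by (rule continuous_on_subset[of UNIV]) (auto simp: continuous_on_open_vimage open_angle_def)

text \<open>The full preimage of the image of \<open>S\<close> is the union of the translates of
  \<open>S\<close> by integer multiples of \<open>2 * pi\<close>, hence open; in the quotient
  topology this is all that openness asks.\<close>

lemma open_image_abs_angle:
  assumes "open S"
  shows "open (abs_angle ` S)"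
proof -
  have "abs_angle -` abs_angle ` S = (\<Union>k::int. (\<lambda>x. 2 * pi * of_int k + x) ` S)"
  proof (intro equalityI subsetI)
    fix x assume "x \<in> abs_angle -` abs_angle ` S"
    then obtain y k where "y \<in> S" "x - y = 2 * pi * of_int (k::int)"
      by (auto simp: angle.abs_eq_iff)
    then have "y \<in> S \<and> x = 2 * pi * of_int k + y" by simp
    then show "x \<in> (\<Union>k::int. (\<lambda>x. 2 * pi * of_int k + x) ` S)" by blast
  next
    fix x assume "x \<in> (\<Union>k::int. (\<lambda>x. 2 * pi * of_int k + x) ` S)"
    then obtain y k where y: "y \<in> S" "x = 2 * pi * of_int (k::int) + y" by blast
    then have "abs_angle x = abs_angle y" by (auto simp: angle.abs_eq_iff)
    then show "x \<in> abs_angle -` abs_angle ` S" using y by simp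
  qed
  then show ?thesis
    using assms by (auto simp: open_angle_def intro: open_translation)
qed

lemma continuous_to_torus: "continuous_on S to_torus"
  unfolding to_torus_def
  by (intro continuous_on_vec_lambda continuous_on_compose2[OF continuous_abs_angle[of UNIV]]
      continuous_intros) auto

text \<open>The torus carries the product topology, so boxes suffice: a box inside \<open>S\<close>
  maps onto the product of the images of its sides, each of which is open.\<close>

lemma open_image_to_torus:
  assumes "open S"
  shows "open (to_torus ` S)"
  unfolding open_vec_def
proof
  fix t assume "t \<in> to_torus ` S"
  then obtain \<theta> where \<theta>: "\<theta> \<in> S" "t = to_torus \<theta>" by blast
  obtain A where A: "\<forall>i. open (A i) \<and> \<theta> $ i \<in> A i"
    "\<forall>y. (\<forall>i. y $ i \<in> A i) \<longrightarrow> y \<in> S"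
    using bspec[OF assms[unfolded open_vec_def] \<theta>(1)] by (elim exE conjE) (rule that)
  have "u \<in> to_torus ` S" if u: "\<forall>i. u $ i \<in> abs_angle ` A i" for u
  proof -
    have "\<forall>i. \<exists>a. a \<in> A i \<and> u $ i = abs_angle a" using u by blast
    then obtain y where y: "\<forall>i. y i \<in> A i \<and> u $ i = abs_angle (y i)"
      using choice[of "\<lambda>i a. a \<in> A i \<and> u $ i = abs_angle a"] by blast
    have "u = to_torus (\<chi> i. y i)" using y by (simp add: to_torus_def vec_eq_iff)
    moreover have "(\<chi> i. y i) \<in> S" using A(2) y by simp
    ultimately show ?thesis by blast
  qed
  moreover have "\<forall>i. open (abs_angle ` A i) \<and> t $ i \<in> abs_angle ` A i"
    using A(1) \<theta>(2) by (auto simp: to_torus_def intro: open_image_abs_angle)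
  ultimately show "\<exists>A. (\<forall>i. open (A i) \<and> t $ i \<in> A i) \<and> (\<forall>y. (\<forall>i. y $ i \<in> A i) \<longrightarrow> y \<in> to_torus ` S)"
    by (intro exI[of _ "\<lambda>i. abs_angle ` A i"]) simp
qed

lemma to_torus_eq_iff:
  "to_torus \<theta> = to_torus \<theta>' \<longleftrightarrow> (\<exists>x. \<theta> = \<theta>' + (2 * pi) *\<^sub>R real_vec x)"
proof
  assume "to_torus \<theta> = to_torus \<theta>'"
  then have "\<forall>i. \<exists>k::int. \<theta> $ i - \<theta>' $ i = 2 * pi * of_int k"
    by (simp add: to_torus_def vec_eq_iff angle.abs_eq_iff)
  then obtain k where k: "\<forall>i. \<theta> $ i - \<theta>' $ i = 2 * pi * of_int (k i :: int)" by metis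
  have "\<theta> = \<theta>' + (2 * pi) *\<^sub>R real_vec (\<chi> i. k i)"
    using k by (simp add: vec_eq_iff real_vec_def algebra_simps)
  then show "\<exists>x. \<theta> = \<theta>' + (2 * pi) *\<^sub>R real_vec x" by blast
qed (auto simp: to_torus_def vec_eq_iff angle.abs_eq_iff real_vec_def)

lemma surj_to_torus: "surj to_torus"
proof (rule surjI)
  show "to_torus (\<chi> i. rep_angle (t $ i)) = t" for t :: "'n::finite torus"
    by (simp add: to_torus_def vec_eq_iff Quotient3_abs_rep[OF Quotient3_angle])
qed

section \<open>Integer solutions of linear systems\<close>

lemma det_in_Ints:
  fixes M :: "real ^ 'n::finite ^ 'n"
  assumes "\<And>i j. M $ i $ j \<in> \<int>"
  shows "det M \<in> \<int>"
  unfolding det_def using assms by (intro Ints_sum Ints_mult Ints_of_int Ints_prod)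

lemma of_int_det:
  fixes M :: "int ^ 'n::finite ^ 'n"
  shows "real_of_int (det M) = det (\<chi> i j. real_of_int (M $ i $ j))"
  unfolding det_def by simp

text \<open>Bezout: the integers whose product with \<open>y\<close> is integral are closed under
  integer combinations, so the gcd of finitely many of them is another one.\<close>

lemma Gcd_mult_in_Ints:
  fixes D :: "int set" and y :: real
  assumes "\<And>d. d \<in> D \<Longrightarrow> of_int d * y \<in> \<int>" and "finite D"
  shows "of_int (Gcd D) * y \<in> \<int>"
  using assms(2,1)
proof (induction D)
  case (insert d D)
  obtain u v where uv: "u * d + v * Gcd D = gcd d (Gcd D)" using bezout_int by blast
  have "of_int (Gcd (insert d D)) * y = of_int u * (of_int d * y) + of_int v * (of_int (Gcd D) * y)"
    unfolding Gcd_insert uv[symmetric] by (simp add: algebra_simps)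
  then show ?case using insert by (simp add: Ints_add Ints_mult)
qed simp

text \<open>Cramer's rule for the square system cut out by the columns \<open>\<sigma>\<close>: the
  determinant times an unknown is a determinant with integral entries.\<close>

lemma minor_mult_in_Ints:
  fixes M :: "int ^ 'N::finite ^ 'r::finite" and y :: "'r \<Rightarrow> real"
  assumes "\<And>k. (\<Sum>r\<in>UNIV. y r * of_int (M $ r $ k)) \<in> \<int>"
  shows "of_int (det (\<chi> r s. M $ r $ \<sigma> s)) * y r0 \<in> \<int>"
proof -
  define A :: "real ^ 'r ^ 'r" where "A = (\<chi> s r. of_int (M $ r $ \<sigma> s))"
  define x :: "real ^ 'r" where "x = (\<chi> r. y r)"
  have Ax: "(A *v x) $ s \<in> \<int>" for s
    using assms[of "\<sigma> s"] by (simp add: A_def x_def matrix_vector_mult_def mult.commute)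
  have "det ((\<chi> i j. if j = r0 then (A *v x) $ i else A $ i $ j) :: real ^ 'r ^ 'r) \<in> \<int>"
    using Ax by (intro det_in_Ints) (simp add: A_def)
  then have "x $ r0 * det A \<in> \<int>" by (simp only: cramer_lemma)
  moreover have "det A = of_int (det (\<chi> r s. M $ r $ \<sigma> s))"
  proof -
    have "det A = det (transpose A)" by (simp add: det_transpose)
    also have "\<dots> = of_int (det (\<chi> r s. M $ r $ \<sigma> s))"
      by (simp add: of_int_det transpose_def A_def)
    finally show ?thesis .
  qed
  ultimately show ?thesis by (simp add: x_def mult.commute)
qed

text \<open>Every maximal minor clears the denominators of \<open>y\<close>, hence so does their
  gcd, which is 1. Thus an integral vector in the real row space of \<open>M\<close> has only
  integral coefficients.\<close>

lemma gcd_minors_1_Ints: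
  fixes M :: "int ^ 'N::finite ^ 'r::finite" and y :: "'r \<Rightarrow> real"
  assumes "gcd_maximal_minors M = 1"
    and "\<And>k. (\<Sum>r\<in>UNIV. y r * of_int (M $ r $ k)) \<in> \<int>"
  shows "y r0 \<in> \<int>"
proof -
  let ?D = "{det (\<chi> r s. M $ r $ \<sigma> s) | \<sigma> :: 'r \<Rightarrow> 'N. inj \<sigma>}"
  have "finite ?D" by (simp add: finite_image_set)
  then have "of_int (Gcd ?D) * y r0 \<in> \<int>"
    using minor_mult_in_Ints[where M = M and y = y, OF assms(2)] by (intro Gcd_mult_in_Ints) auto
  then show ?thesis using assms(1) by (simp add: gcd_maximal_minors_def)
qed

lemma gcd_minors_1_inj:
  fixes M :: "int ^ 'N::finite ^ 'r::finite" and y :: "'r \<Rightarrow> real"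
  assumes "gcd_maximal_minors M = 1"
    and "\<And>k. (\<Sum>r\<in>UNIV. y r * of_int (M $ r $ k)) = 0"
  shows "y r0 = 0"
proof (rule ccontr)
  \<comment> \<open>All multiples of a solution of the homogeneous system are integral.\<close>
  assume "y r0 \<noteq> 0"
  \<comment> \<open>The factor is chosen to make the entry at \<open>r0\<close> equal to
    1/2.\<close>
  have "(1 / (2 * y r0)) * y r0 \<in> \<int>"
  proof (rule gcd_minors_1_Ints[where y = "\<lambda>r. (1 / (2 * y r0)) * y r", OF assms(1)])
    show "(\<Sum>r\<in>UNIV. (1 / (2 * y r0)) * y r * of_int (M $ r $ k)) \<in> \<int>" for k
      using assms(2)[of k] by (simp only: mult.assoc flip: sum_distrib_left) simp
  qed
  then have "(1 / 2 :: real) \<in> \<int>" using \<open>y r0 \<noteq> 0\<close> by (simp add: field_simps)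
  then obtain i where "(1 / 2 :: real) = of_int i" by (auto elim: Ints_cases)
  then have "of_int (2 * i) = (1 :: real)" by simp
  then have "2 * i = 1" by linarith
  then show False by presburger
qed

section \<open>Lopsidedness and phase cells\<close>

lemma real_vec_diff: "real_vec (a - b) = real_vec a - real_vec b"
  by (simp add: real_vec_def vec_eq_iff)

lemma real_vec_inner: "real_vec a \<bullet> real_vec b = of_int (\<Sum>i\<in>UNIV. a $ i * b $ i)"
  by (simp add: real_vec_def inner_vec_def)

lemma cos_add_int_mult_2pi: "cos (x + 2 * pi * of_int n) = cos x"
  using sin_cos_eq_iff[of "x + 2 * pi * of_int n" x] by auto

text \<open>The principal argument of \<open>cis x\<close> is the required representative: it lies
  in \<open>(-pi, pi]\<close>, where the cosine is negative beyond distance \<open>pi / 2\<close>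
  from 0.\<close>

lemma cos_nonneg_obtain:
  assumes "cos x \<ge> 0"
  obtains n :: int where "\<bar>x + 2 * pi * of_int n\<bar> \<le> pi / 2"
proof -
  have "cis (Arg (cis x)) = cis x" by (simp add: cis_Arg sgn_div_norm)
  then obtain n :: int where n: "Arg (cis x) = x + 2 * pi * of_int n"
    using sin_cos_eq_iff[of "Arg (cis x)" x] by (auto simp: complex_eq_iff)
  have "\<not> \<bar>Arg (cis x)\<bar> > pi / 2"
  proof
    assume *: "\<bar>Arg (cis x)\<bar> > pi / 2"
    have "\<bar>Arg (cis x)\<bar> \<le> pi" using Arg_bounded[of "cis x"] by linarith
    then have "cos \<bar>Arg (cis x)\<bar> < cos (pi / 2)"
      using * pi_gt_zero by (intro cos_monotone_0_pi) linarith+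
    then show False using assms n cos_add_int_mult_2pi[of x n] by simp
  qed
  then show ?thesis using n that[of n] by simp
qed

text \<open>The inner product form gives access to the known closures and frontiers of
  half-spaces.\<close>

lemma half_space_eq: "half_space \<phi> = {z. cis (- \<phi>) \<bullet> z > 0}"
  by (simp add: half_space_def inner_complex_def)

text \<open>Here \<open>\<phi>\<close> is the direction of the inner normal, the negative of the
  angle in \<open>half_space\<close>. Lying in the closure means nonnegative cosines, and not lying
  in the frontier means a positive one.\<close>

lemma lopsided_iff:
  "lopsided c \<alpha> \<theta> \<longleftrightarrow>
    (\<exists>\<phi>. (\<forall>k. 0 \<le> cos (Arg (c k) + real_vec (\<alpha> k) \<bullet> \<theta> - \<phi>)) \<and>
         (\<exists>k. 0 < cos (Arg (c k) + real_vec (\<alpha> k) \<bullet> \<theta> - \<phi>)))" (is "_ \<longleftrightarrow> (\<exists>\<phi>. ?P \<phi>)")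
proof -
  have inner: "cis \<phi> \<bullet> phases c \<alpha> \<theta> k = cos (Arg (c k) + real_vec (\<alpha> k) \<bullet> \<theta> - \<phi>)" for \<phi> k
    by (simp add: phases_def inner_complex_def cos_diff mult.commute)
  have "(range (phases c \<alpha> \<theta>) \<subseteq> closure (half_space (- \<phi>)) \<and>
      \<not> range (phases c \<alpha> \<theta>) \<subseteq> frontier (half_space (- \<phi>))) \<longleftrightarrow> ?P \<phi>" for \<phi>
    by (auto simp: half_space_eq frontier_halfspace_gt inner image_subset_iff)
      (metis order_le_less less_irrefl)+
  then show ?thesis unfolding lopsided_def by (metis minus_minus)
qed

text \<open>The points at which, for the branch of the arguments prescribed by \<open>z\<close>, all phases lie in
  one open half-plane.\<close>

definition phase_cell ::
    "('N::finite \<Rightarrow> complex) \<Rightarrow> ('N \<Rightarrow> int ^ 'n) \<Rightarrow> ('N \<Rightarrow> int) \<Rightarrow> (real ^ 'n::finite) set" where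
  "phase_cell c \<alpha> z =
     {\<theta>. \<exists>\<phi>. \<forall>k. \<bar>Arg (c k) + real_vec (\<alpha> k) \<bullet> \<theta> + 2 * pi * of_int (z k) - \<phi>\<bar> < pi / 2}"

lemma open_phase_cell: "open (phase_cell c \<alpha> z)"
proof -
  have "phase_cell c \<alpha> z = (\<Union>\<phi>. \<Inter>k.
      {\<theta>. \<bar>Arg (c k) + real_vec (\<alpha> k) \<bullet> \<theta> + 2 * pi * of_int (z k) - \<phi>\<bar> < pi / 2})"
    by (auto simp: phase_cell_def)
  also have "open \<dots>"
    by (intro open_UN ballI open_INT finite open_Collect_less continuous_intros)
  finally show ?thesis .
qed

text \<open>The bounded quantity is affine in the pair of \<open>\<theta>\<close> and
  \<open>\<phi>\<close>, so a convex combination of centres serves the convex combination of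
  points.\<close>

lemma convex_phase_cell: "convex (phase_cell c \<alpha> z)"
proof (rule convexI)
  fix \<theta> \<theta>' and u v :: real
  assume "\<theta> \<in> phase_cell c \<alpha> z" "\<theta>' \<in> phase_cell c \<alpha> z" and uv: "0 \<le> u" "0 \<le> v" "u + v = 1"
  define e where "e \<theta> \<phi> k = Arg (c k) + real_vec (\<alpha> k) \<bullet> \<theta> + 2 * pi * of_int (z k) - \<phi>" for \<theta> \<phi> k
  obtain \<phi> \<phi>' where *: "\<And>k. \<bar>e \<theta> \<phi> k\<bar> < pi / 2" "\<And>k. \<bar>e \<theta>' \<phi>' k\<bar> < pi / 2"
    using \<open>\<theta> \<in> _\<close> \<open>\<theta>' \<in> _\<close> by (auto simp: phase_cell_def e_def)
  have "\<bar>e (u *\<^sub>R \<theta> + v *\<^sub>R \<theta>') (u * \<phi> + v * \<phi>') k\<bar> < pi / 2" for k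
  proof -
    have v: "v = 1 - u" using uv by simp
    have "e (u *\<^sub>R \<theta> + v *\<^sub>R \<theta>') (u * \<phi> + v * \<phi>') k = u * e \<theta> \<phi> k + v * e \<theta>' \<phi>' k"
      unfolding e_def v by (simp add: inner_add_right algebra_simps)
    also have "\<bar>\<dots>\<bar> \<le> u * \<bar>e \<theta> \<phi> k\<bar> + v * \<bar>e \<theta>' \<phi>' k\<bar>"
      using uv by (metis abs_mult abs_of_nonneg abs_triangle_ineq)
    also have "\<dots> < pi / 2" using * uv by (intro convex_bound_lt)
    finally show ?thesis .
  qed
  then show "u *\<^sub>R \<theta> + v *\<^sub>R \<theta>' \<in> phase_cell c \<alpha> z"
    by (auto simp: phase_cell_def e_def)
qed

text \<open>A translation by a period adds to the index the combination of the coordinate rows with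
  coefficients \<open>x\<close>; the constant \<open>a\<close>, a multiple of the row of ones, is
  absorbed by the centre \<open>\<phi>\<close>.\<close>

lemma phase_cell_shift:
  "\<theta> + (2 * pi) *\<^sub>R real_vec x \<in> phase_cell c \<alpha> z \<longleftrightarrow>
   \<theta> \<in> phase_cell c \<alpha> (\<lambda>k. z k + (a + (\<Sum>i\<in>UNIV. \<alpha> k $ i * x $ i)))"
proof -
  define s where "s k = (\<Sum>i\<in>UNIV. \<alpha> k $ i * x $ i)" for k
  have s: "real_vec (\<alpha> k) \<bullet> (\<theta> + (2 * pi) *\<^sub>R real_vec x) = real_vec (\<alpha> k) \<bullet> \<theta> + 2 * pi * of_int (s k)" for k
    by (simp add: inner_add_right real_vec_inner s_def)
  have eq: "Arg (c k) + real_vec (\<alpha> k) \<bullet> (\<theta> + (2 * pi) *\<^sub>R real_vec x) + 2 * pi * of_int (z k) - \<phi> =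
      Arg (c k) + real_vec (\<alpha> k) \<bullet> \<theta> + 2 * pi * of_int (z k + (a + s k)) - (\<phi> + 2 * pi * of_int a)" for k \<phi>
    unfolding s by (simp add: algebra_simps)
  have "(\<exists>\<phi>. P (\<phi> + 2 * pi * of_int a)) \<longleftrightarrow> (\<exists>\<phi>. P \<phi>)" for P :: "real \<Rightarrow> bool"
    by (metis diff_add_cancel)
  then show ?thesis
    unfolding phase_cell_def mem_Collect_eq eq s_def[symmetric] .
qed

lemma phase_cell_lopsided:
  assumes "\<theta> \<in> phase_cell c \<alpha> z"
  shows "lopsided c \<alpha> \<theta>"
proof -
  obtain \<phi> where \<phi>: "\<And>k. \<bar>Arg (c k) + real_vec (\<alpha> k) \<bullet> \<theta> + 2 * pi * of_int (z k) - \<phi>\<bar> < pi / 2"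
    using assms by (auto simp: phase_cell_def)
  have "0 < cos (Arg (c k) + real_vec (\<alpha> k) \<bullet> \<theta> - \<phi>)" for k
  proof -
    have "0 < cos (Arg (c k) + real_vec (\<alpha> k) \<bullet> \<theta> - \<phi> + 2 * pi * of_int (z k))"
      using \<phi>[of k] unfolding abs_less_iff by (intro cos_gt_zero_pi) linarith+
    then show ?thesis by (simp only: cos_add_int_mult_2pi)
  qed
  then show ?thesis unfolding lopsided_iff by (metis less_imp_le)
qed

text \<open>Going round the circle from \<open>i\<close> to \<open>l\<close>, on to \<open>j\<close>
  and back to \<open>i\<close>, each turn is positive and less than \<open>pi\<close>. The origin is
  then interior to the triangle of these phases, so no closed half-plane bounded by a line through
  it contains all three.\<close>

lemma not_lopsidedI:
  fixes z :: "'N::finite \<Rightarrow> int"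
  defines "E \<equiv> \<lambda>c \<alpha> \<theta> k. Arg (c k) + real_vec (\<alpha> k) \<bullet> \<theta> + 2 * pi * of_int (z k)"
  assumes ij: "pi < E c \<alpha> \<theta> j - E c \<alpha> \<theta> i" "E c \<alpha> \<theta> j - E c \<alpha> \<theta> i < 2 * pi"
    and il: "0 < E c \<alpha> \<theta> l - E c \<alpha> \<theta> i" "E c \<alpha> \<theta> l - E c \<alpha> \<theta> i < pi"
    and lj: "0 < E c \<alpha> \<theta> j - E c \<alpha> \<theta> l" "E c \<alpha> \<theta> j - E c \<alpha> \<theta> l < pi"
  shows "\<not> lopsided c \<alpha> \<theta>"
proof
  assume "lopsided c \<alpha> \<theta>"
  then obtain \<phi> where \<phi>: "\<And>k. 0 \<le> cos (Arg (c k) + real_vec (\<alpha> k) \<bullet> \<theta> - \<phi>)"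
    unfolding lopsided_iff by blast
  define e where "e k = E c \<alpha> \<theta> k - \<phi>" for k
  have e: "0 \<le> cos (e k)" for k
    using \<phi>[of k] cos_add_int_mult_2pi[of "Arg (c k) + real_vec (\<alpha> k) \<bullet> \<theta> - \<phi>" "z k"]
    by (simp add: e_def E_def algebra_simps)
  have pos: "0 < sin (e j - e l)" "0 < sin (e l - e i)" "0 < sin (e i - e j)"
    using ij il lj sin_gt_zero[of "e i - e j + 2 * pi"] by (auto simp: e_def intro: sin_gt_zero)
  \<comment> \<open>The three phases span \<open>0\<close> with positive coefficients.\<close>
  have "sin (e j - e l) * cos (e i) + sin (e i - e j) * cos (e l) + sin (e l - e i) * cos (e j) = 0"
    by (simp add: sin_diff algebra_simps)
  moreover have "0 \<le> sin (e j - e l) * cos (e i)" "0 \<le> sin (e i - e j) * cos (e l)"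
      "0 \<le> sin (e l - e i) * cos (e j)"
    using pos e by (simp_all add: less_imp_le)
  ultimately have "sin (e j - e l) * cos (e i) = 0" "sin (e i - e j) * cos (e l) = 0" by linarith+
  then have "cos (e i) = 0" "cos (e l) = 0" using pos by auto
  \<comment> \<open>Two phases on the same boundary line are equal or antipodal.\<close>
  then have "sin (e l - e i) = 0" by (simp add: sin_diff)
  then show False using pos by simp
qed

lemma finite_pos_lower_bound:
  fixes f :: "'k::finite \<Rightarrow> real"
  assumes "\<And>k. 0 < f k"
  obtains \<delta> where "0 < \<delta>" "\<And>k. \<delta> < f k"
proof
  have "Min (range f) \<in> range f" by (intro Min_in) auto
  then have "0 < Min (range f)" using assms by auto
  then show "0 < Min (range f) / 2" by simp
  show "Min (range f) / 2 < f k" for k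
  proof -
    have "Min (range f) \<le> f k" by (intro Min_le) auto
    then show ?thesis using \<open>0 < Min (range f)\<close> by linarith
  qed
qed

text \<open>A lopsided point outside all cells has two antipodal phases and a third one strictly to one
  side; moving along the difference of the two exponents pushes the antipodal pair apart.\<close>

lemma lopsided_outside_phase_cells:
  assumes "inj \<alpha>" "lopsided c \<alpha> \<theta>" "\<And>z. \<theta> \<notin> phase_cell c \<alpha> z"
  shows "\<theta> \<in> closure {\<theta>. \<not> lopsided c \<alpha> \<theta>}"
proof -
  define t where "t k = Arg (c k) + real_vec (\<alpha> k) \<bullet> \<theta>" for k
  obtain \<phi> l where \<phi>: "\<And>k. 0 \<le> cos (t k - \<phi>)" and l: "0 < cos (t l - \<phi>)"
    using assms(2) unfolding lopsided_iff t_def by blast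
  have "\<forall>k. \<exists>n::int. \<bar>t k - \<phi> + 2 * pi * of_int n\<bar> \<le> pi / 2"
    using cos_nonneg_obtain[OF \<phi>] by metis
  then obtain z where z: "\<And>k. \<bar>t k - \<phi> + 2 * pi * of_int (z k :: int)\<bar> \<le> pi / 2" by metis
  define E where "E k = t k + 2 * pi * of_int (z k)" for k
  have E: "\<phi> - pi / 2 \<le> E k \<and> E k \<le> \<phi> + pi / 2" for k
    using z[of k] unfolding E_def abs_le_iff by linarith
  have notin: "\<not> (\<forall>k. \<bar>E k - \<psi>\<bar> < pi / 2)" for \<psi>
    using assms(3)[of z] by (auto simp: phase_cell_def E_def t_def)
  \<comment> \<open>If no phase sat at the left end, moving the centre to the right by a small
    \<open>\<delta>\<close> would bring all of them into an open interval of length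
    \<open>pi\<close>, putting \<open>\<theta>\<close> into the cell of \<open>z\<close>. The right
    end is treated symmetrically.\<close>
  have "\<exists>i. E i = \<phi> - pi / 2"
  proof (rule ccontr)
    assume "\<nexists>i. E i = \<phi> - pi / 2"
    then have "0 < E k - (\<phi> - pi / 2)" for k using E[of k] by (metis diff_gt_0_iff_gt order_le_less)
    then obtain \<delta> where "0 < \<delta>" "\<And>k. \<delta> < E k - (\<phi> - pi / 2)"
      using finite_pos_lower_bound[of "\<lambda>k. E k - (\<phi> - pi / 2)"] by blast
    then have "\<bar>E k - (\<phi> + \<delta>)\<bar> < pi / 2" for k
      using E[of k] by (smt (verit))
    then show False using notin by blast
  qed
  then obtain i where i: "E i = \<phi> - pi / 2" ..
  have "\<exists>j. E j = \<phi> + pi / 2"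
  proof (rule ccontr)
    assume "\<nexists>j. E j = \<phi> + pi / 2"
    then have "0 < (\<phi> + pi / 2) - E k" for k using E[of k] by (metis diff_gt_0_iff_gt order_le_less)
    then obtain \<delta> where "0 < \<delta>" "\<And>k. \<delta> < (\<phi> + pi / 2) - E k"
      using finite_pos_lower_bound[of "\<lambda>k. (\<phi> + pi / 2) - E k"] by blast
    then have "\<bar>E k - (\<phi> - \<delta>)\<bar> < pi / 2" for k
      using E[of k] by (smt (verit))
    then show False using notin by blast
  qed
  then obtain j where j: "E j = \<phi> + pi / 2" ..
  have "cos (E l - \<phi>) = cos (t l - \<phi>)"
    using cos_add_int_mult_2pi[of "t l - \<phi>" "z l"] by (simp add: E_def algebra_simps)
  then have "E l \<noteq> \<phi> - pi / 2" "E l \<noteq> \<phi> + pi / 2" using l by auto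
  then have l': "\<phi> - pi / 2 < E l" "E l < \<phi> + pi / 2" using E[of l] by auto
  define d where "d = real_vec (\<alpha> j) - real_vec (\<alpha> i)"
  have "\<alpha> i \<noteq> \<alpha> j" using i j assms(1) by (auto dest: injD)
  then have "d \<noteq> 0" unfolding d_def real_vec_def vec_eq_iff by auto metis
  then have d: "0 < real_vec (\<alpha> j) \<bullet> d - real_vec (\<alpha> i) \<bullet> d"
    by (simp add: d_def flip: inner_diff_left)
  define F where "F s k = E k + s * (real_vec (\<alpha> k) \<bullet> d)" for s k
  have F: "F s k = Arg (c k) + real_vec (\<alpha> k) \<bullet> (\<theta> + s *\<^sub>R d) + 2 * pi * of_int (z k)" for s k
    by (simp add: F_def E_def t_def inner_add_right)
  have lim: "((\<lambda>s. F s a - F s b) \<longlongrightarrow> E a - E b) (at_right 0)" for a b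
    unfolding F_def by (auto intro!: tendsto_eq_intros)
  have "\<forall>\<^sub>F s in at_right 0. \<theta> + s *\<^sub>R d \<in> {\<theta>. \<not> lopsided c \<alpha> \<theta>}"
  proof -
    \<comment> \<open>This gap tends to exactly \<open>pi\<close>, so continuity cannot give the
      bound; the choice of \<open>d\<close> supplies a positive linear term. The other five
      inequalities are strict in the limit.\<close>
    have "\<forall>\<^sub>F s in at_right 0. pi < F s j - F s i"
      using eventually_at_right_less[of 0]
    proof eventually_elim
      case (elim s)
      have "F s j - F s i = pi + s * (real_vec (\<alpha> j) \<bullet> d - real_vec (\<alpha> i) \<bullet> d)"
        by (simp add: F_def i j algebra_simps)
      then show ?case using elim d by simp
    qed
    moreover have "\<forall>\<^sub>F s in at_right 0. F s j - F s i < 2 * pi"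
      using i j by (intro order_tendstoD(2)[OF lim]) simp
    moreover have "\<forall>\<^sub>F s in at_right 0. 0 < F s l - F s i"
      using i l' by (intro order_tendstoD(1)[OF lim]) simp
    moreover have "\<forall>\<^sub>F s in at_right 0. F s l - F s i < pi"
      using i l' by (intro order_tendstoD(2)[OF lim]) simp
    moreover have "\<forall>\<^sub>F s in at_right 0. 0 < F s j - F s l"
      using j l' by (intro order_tendstoD(1)[OF lim]) simp
    moreover have "\<forall>\<^sub>F s in at_right 0. F s j - F s l < pi"
      using j l' by (intro order_tendstoD(2)[OF lim]) simp
    ultimately show ?thesis
    proof eventually_elim
      case (elim s)
      then show ?case unfolding F using not_lopsidedI[where z = z and i = i and j = j and l = l] by blast
    qed
  qed
  then have "\<forall>\<^sub>F s in at_right 0. \<theta> + s *\<^sub>R d \<in> closure {\<theta>. \<not> lopsided c \<alpha> \<theta>}"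
    by (rule eventually_mono) (rule subsetD[OF closure_subset])
  moreover have "((\<lambda>s. \<theta> + s *\<^sub>R d) \<longlongrightarrow> \<theta>) (at_right 0)"
    by (auto intro!: tendsto_eq_intros)
  ultimately show ?thesis
    by (intro Lim_in_closed_set[of _ "\<lambda>s. \<theta> + s *\<^sub>R d" "at_right (0::real)"]) auto
qed

text \<open>Two lifts of a torus point differ by a period, which moves the index of a cell by an
  integer combination of the coordinate rows.\<close>

lemma phase_cell_to_torus:
  assumes "to_torus \<theta> = to_torus \<theta>'" "\<theta>' \<in> phase_cell c \<alpha> z"
  obtains x where "\<theta> \<in> phase_cell c \<alpha> (\<lambda>k. z k + (\<Sum>i\<in>UNIV. \<alpha> k $ i * x $ i))"
proof -
  obtain x where "\<theta>' = \<theta> + (2 * pi) *\<^sub>R real_vec x"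
    using assms(1) to_torus_eq_iff by metis
  then have "\<theta> \<in> phase_cell c \<alpha> (\<lambda>k. z k + (0 + (\<Sum>i\<in>UNIV. \<alpha> k $ i * x $ i)))"
    using assms(2) phase_cell_shift by blast
  then show ?thesis using that by simp
qed

text \<open>Images of cells are open and miss the coamoeba, hence also its closure. Conversely, by
  continuity of \<open>to_torus\<close>, a lift of a point off the closure avoids the closure of the
  non-lopsided set upstairs, and such a lift lies in a cell.\<close>

lemma compl_closure_lopsided_coamoeba:
  assumes "inj \<alpha>"
  shows "- closure (lopsided_coamoeba c \<alpha>) = to_torus ` (\<Union>z. phase_cell c \<alpha> z)" (is "_ = ?V")
proof (rule antisym)
  have "open ?V" by (intro open_image_to_torus open_UN ballI open_phase_cell)
  moreover have "?V \<inter> lopsided_coamoeba c \<alpha> = {}"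
  proof (rule ccontr)
    assume "?V \<inter> lopsided_coamoeba c \<alpha> \<noteq> {}"
    then obtain \<theta> \<theta>' z where *: "\<theta>' \<in> phase_cell c \<alpha> z" "\<not> lopsided c \<alpha> \<theta>"
        "to_torus \<theta> = to_torus \<theta>'"
      unfolding lopsided_coamoeba_def by (auto simp: set_eq_iff)
    then show False by (meson phase_cell_to_torus phase_cell_lopsided)
  qed
  ultimately show "?V \<subseteq> - closure (lopsided_coamoeba c \<alpha>)"
    using open_Int_closure_eq_empty[of ?V] by blast
next
  show "- closure (lopsided_coamoeba c \<alpha>) \<subseteq> ?V"
  proof
    fix t assume t: "t \<in> - closure (lopsided_coamoeba c \<alpha>)"
    obtain \<theta> where \<theta>: "t = to_torus \<theta>" using surj_to_torus by (rule surjE)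
    have "to_torus ` closure {\<theta>. \<not> lopsided c \<alpha> \<theta>} \<subseteq> closure (lopsided_coamoeba c \<alpha>)"
      unfolding lopsided_coamoeba_def
      by (intro image_closure_subset continuous_to_torus closed_closure closure_subset)
    then have "\<theta> \<notin> closure {\<theta>. \<not> lopsided c \<alpha> \<theta>}" using t \<theta> by blast
    then have "\<exists>z. \<theta> \<in> phase_cell c \<alpha> z"
      using lopsided_outside_phase_cells[OF assms, of c \<theta>]
        subsetD[OF closure_subset, of \<theta> "{\<theta>. \<not> lopsided c \<alpha> \<theta>}"] by blast
    then show "t \<in> ?V" using \<theta> by blast
  qed
qed

section \<open>The order map on a phase cell\<close>

lemma cis_int_mult_2pi: "cis (x + 2 * pi * of_int n) = cis x"
  using sin_cos_eq_iff[of "x + 2 * pi * of_int n" x] by (auto simp: complex_eq_iff)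

text \<open>In a cell any two lifted phases differ by less than \<open>pi\<close>, so the principal
  argument of a quotient is their difference without wrap-around. Hence \<open>p_vec\<close> has the
  entries \<open>2 * pi * (z k - z l)\<close>.\<close>

lemma v_vec_phase_cell:
  assumes "\<forall>k. c k \<noteq> 0" "\<And>j. (\<Sum>k\<in>UNIV. B k j) = 0" "\<theta> \<in> phase_cell c \<alpha> z"
  shows "v_vec c \<alpha> B l \<theta> =
    (\<lambda>j. row_times (Arg_vec c) B j + 2 * pi * of_int (\<Sum>k\<in>UNIV. z k * B k j))"
proof
  fix j
  define t where "t k = Arg (c k) + real_vec (\<alpha> k) \<bullet> \<theta>" for k
  obtain \<phi> where \<phi>: "\<And>k. \<bar>t k + 2 * pi * of_int (z k) - \<phi>\<bar> < pi / 2"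
    using assms(3) by (auto simp: phase_cell_def t_def)
  have "Arg ((c k * cis (real_vec (\<alpha> k) \<bullet> \<theta>)) / (c l * cis (real_vec (\<alpha> l) \<bullet> \<theta>)))
      = t k - t l + 2 * pi * of_int (z k - z l)" for k
  proof (rule Arg_unique')
    show "0 < cmod (c k) / cmod (c l)" using assms(1) by simp
    have "\<bar>(t k + 2 * pi * of_int (z k) - \<phi>) - (t l + 2 * pi * of_int (z l) - \<phi>)\<bar> < pi"
      using \<phi>[of k] \<phi>[of l] by linarith
    then have "\<bar>t k - t l + 2 * pi * of_int (z k - z l)\<bar> < pi"
      by (simp add: algebra_simps)
    then show "t k - t l + 2 * pi * of_int (z k - z l) \<in> {- pi<..pi}"
      unfolding abs_less_iff by simp
    have "c i * cis (real_vec (\<alpha> i) \<bullet> \<theta>) = of_real (cmod (c i)) * cis (t i)" for i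
    proof -
      have "c i = of_real (cmod (c i)) * cis (Arg (c i))"
        using rcis_cmod_Arg[of "c i"] by (simp add: rcis_def)
      then show ?thesis by (metis t_def cis_mult mult.assoc)
    qed
    then show "(c k * cis (real_vec (\<alpha> k) \<bullet> \<theta>)) / (c l * cis (real_vec (\<alpha> l) \<bullet> \<theta>)) =
        rcis (cmod (c k) / cmod (c l)) (t k - t l + 2 * pi * of_int (z k - z l))"
      unfolding rcis_def cis_int_mult_2pi by (simp add: cis_divide[symmetric])
  qed
  then have "(Arg_vec c + p_vec c \<alpha> l \<theta>) $ k = Arg (c k) + 2 * pi * of_int (z k - z l)" for k
    by (simp add: Arg_vec_def p_vec_def t_def real_vec_diff inner_diff_left)
  then have "v_vec c \<alpha> B l \<theta> j =
      (\<Sum>k\<in>UNIV. (Arg (c k) + 2 * pi * of_int (z k - z l)) * of_int (B k j))"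
    by (simp add: v_vec_def row_times_def)
  \<comment> \<open>The base index \<open>l\<close> only contributes a multiple of a column sum of
    \<open>B\<close>, which is zero.\<close>
  also have "\<dots> = row_times (Arg_vec c) B j
      + 2 * pi * (of_int (\<Sum>k\<in>UNIV. z k * B k j) - of_int (z l) * of_int (\<Sum>k\<in>UNIV. B k j))"
    by (simp add: row_times_def Arg_vec_def algebra_simps sum.distrib sum_subtractf sum_distrib_left)
  finally show "v_vec c \<alpha> B l \<theta> j =
      row_times (Arg_vec c) B j + 2 * pi * of_int (\<Sum>k\<in>UNIV. z k * B k j)"
    by (simp add: assms(2) del: of_int_sum)
qed

section \<open>Dual matrices\<close>

definition real_column :: "('N::finite \<Rightarrow> nat \<Rightarrow> int) \<Rightarrow> nat \<Rightarrow> real ^ 'N" where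
  "real_column B j = (\<chi> k. of_int (B k j))"

lemma dual_matrix_exponent_matrix:
  assumes "dual_matrix m (exponent_matrix \<alpha>) B"
  shows "(\<Sum>k\<in>UNIV. B k j) = 0" "(\<Sum>k\<in>UNIV. \<alpha> k $ i * B k j) = 0"
proof -
  have *: "(\<Sum>k\<in>UNIV. exponent_matrix \<alpha> $ r $ k * B k j) = 0" for r
    using assms by (auto simp: dual_matrix_def)
  show "(\<Sum>k\<in>UNIV. B k j) = 0" "(\<Sum>k\<in>UNIV. \<alpha> k $ i * B k j) = 0"
    using *[of None] *[of "Some i"] by (simp_all add: exponent_matrix_def)
qed

text \<open>The rank condition concerns the set of columns, which does not record repetitions; but
  at most \<open>m\<close> vectors spanning dimension \<open>m\<close> must be \<open>m\<close>
  distinct independent ones.\<close>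

lemma dual_matrix_independent:
  assumes "dual_matrix m M B"
  shows "independent (real_column B ` {..<m})" "inj_on (real_column B) {..<m}"
proof -
  let ?S = "real_column B ` {..<m}"
  have dim: "dim ?S = m" using assms by (simp add: dual_matrix_def real_column_def)
  have "dim ?S \<le> card ?S" by (rule dim_le_card') simp
  moreover have "card ?S \<le> m" using card_image_le[of "{..<m}" "real_column B"] by simp
  ultimately have card: "card ?S = m" using dim by simp
  show "independent ?S"
    by (rule card_le_dim_spanning[of _ "span ?S"])
      (use card dim in \<open>auto simp: span_superset\<close>)
  show "inj_on (real_column B) {..<m}"
    using card by (intro eq_card_imp_inj_on) auto
qed

text \<open>The row space of \<open>M\<close> is contained in the left kernel of \<open>B\<close> and has the same dimension; over
  the integers they agree because the maximal minors are coprime.\<close>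

lemma left_kernel_dual_matrix:
  fixes M :: "int ^ 'N::finite ^ 'r::finite"
  assumes gcd: "gcd_maximal_minors M = 1" and dual: "dual_matrix m M B"
    and m: "m = CARD('N) - CARD('r)"
    and z: "\<And>j. (\<Sum>k\<in>UNIV. z k * B k j) = 0"
  obtains y :: "'r \<Rightarrow> int" where "\<And>k. z k = (\<Sum>r\<in>UNIV. y r * M $ r $ k)"
proof -
  define L :: "real ^ 'r \<Rightarrow> real ^ 'N" where "L y = (\<chi> k. \<Sum>r\<in>UNIV. y $ r * of_int (M $ r $ k))" for y
  have "linear L"
    by (rule linearI) (auto simp: L_def vec_eq_iff algebra_simps sum.distrib sum_distrib_left)
  moreover have "inj L"
  proof (rule linear_injective_0[OF \<open>linear L\<close>, THEN iffD2], intro allI impI)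
    fix y assume "L y = 0"
    then have "y $ r = 0" for r
      by (intro gcd_minors_1_inj[OF gcd, of "\<lambda>r. y $ r"]) (simp add: L_def vec_eq_iff)
    then show "y = 0" by (simp add: vec_eq_iff)
  qed
  ultimately have dimL: "dim (range L) = CARD('r)"
    by (simp add: dim_image_eq)
  let ?S = "span (real_column B ` {..<m})"
  \<comment> \<open>The real left kernel of \<open>B\<close>, as the orthogonal complement of its
    columns.\<close>
  define W where "W = {w. \<forall>x\<in>?S. orthogonal x w}"
  have W: "w \<in> W \<longleftrightarrow> (\<forall>j<m. real_column B j \<bullet> w = 0)" for w
  proof
    assume "\<forall>j<m. real_column B j \<bullet> w = 0"
    then have "?S \<subseteq> {x. orthogonal x w}"
      by (intro span_minimal) (auto simp: orthogonal_def subspace_def inner_add_left)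
    then show "w \<in> W" by (auto simp: W_def)
  qed (auto simp: W_def orthogonal_def span_base)
  have "dim W + dim ?S = CARD('N)"
    using dim_subspace_orthogonal_to_vectors[of ?S UNIV] by (simp add: W_def)
  moreover have "dim ?S = m" using dual by (simp add: dual_matrix_def real_column_def)
  \<comment> \<open>Subtraction on \<open>nat\<close> truncates: only with this bound is
    \<open>m\<close> the true difference, which makes the dimension of \<open>W\<close> the number
    of rows of \<open>M\<close>.\<close>
  moreover have "CARD('r) \<le> CARD('N)"
    using dimL dim_subset_UNIV[of "range L"] by simp
  ultimately have "dim W \<le> dim (range L)" using m dimL by simp
  moreover have "range L \<subseteq> W"
  proof (clarsimp simp: W)
    fix y j
    have "real_column B j \<bullet> L y =
        (\<Sum>k\<in>UNIV. \<Sum>r\<in>UNIV. y $ r * of_int (M $ r $ k * B k j))"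
      by (simp add: inner_vec_def real_column_def L_def sum_distrib_left mult_ac)
    also have "\<dots> = (\<Sum>r\<in>UNIV. y $ r * of_int (\<Sum>k\<in>UNIV. M $ r $ k * B k j))"
      by (subst sum.swap) (simp add: sum_distrib_left)
    also have "\<dots> = 0" using dual by (simp add: dual_matrix_def del: of_int_sum)
    finally show "real_column B j \<bullet> L y = 0" .
  qed
  moreover have "subspace W"
    unfolding W_def by (auto simp: subspace_def orthogonal_def inner_add_right)
  moreover have "subspace (range L)"
    using \<open>linear L\<close> by (intro linear_subspace_image subspace_UNIV)
  ultimately have "range L = W" by (intro subspace_dim_equal)
  moreover have "(\<chi> k. of_int (z k)) \<in> W"
  proof -
    have "real_column B j \<bullet> (\<chi> k. of_int (z k)) = of_int (\<Sum>k\<in>UNIV. z k * B k j)" for j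
      by (simp add: real_column_def inner_vec_def mult.commute)
    then show ?thesis by (simp add: W z del: of_int_sum)
  qed
  ultimately obtain y where y: "(\<chi> k. of_int (z k)) = L y" by blast
  then have zy: "of_int (z k) = (\<Sum>r\<in>UNIV. y $ r * of_int (M $ r $ k))" for k
    by (simp add: L_def vec_eq_iff)
  have "y $ r \<in> \<int>" for r
    by (intro gcd_minors_1_Ints[OF gcd, of "\<lambda>r. y $ r"]) (simp flip: zy)
  then have "\<forall>r. \<exists>n::int. y $ r = of_int n" by (metis Ints_cases)
  then obtain n :: "'r \<Rightarrow> int" where n: "\<And>r. y $ r = of_int (n r)" by metis
  have "real_of_int (z k) = of_int (\<Sum>r\<in>UNIV. n r * M $ r $ k)" for k
    by (simp add: zy n)
  then show ?thesis using that of_int_eq_iff by blast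
qed

text \<open>Independence provides a linear functional that is 1 on one vector and 0 on the others;
  its adjoint at 1 represents it as an inner product.\<close>

lemma dual_basis:
  fixes b :: "nat \<Rightarrow> 'a::euclidean_space"
  assumes "independent (b ` {..<m})" "inj_on b {..<m}"
  obtains \<rho> where "\<And>i j. i < m \<Longrightarrow> j < m \<Longrightarrow> b j \<bullet> \<rho> i = (if i = j then 1 else 0)"
proof -
  have "\<exists>r. \<forall>j<m. b j \<bullet> r = (if i = j then 1 else 0)" if "i < m" for i
  proof -
    obtain g :: "'a \<Rightarrow> real" where g: "linear g"
      "\<forall>x\<in>b ` {..<m}. g x = (if x = b i then 1 else 0)"
      using linear_independent_extend[OF assms(1), of "\<lambda>x. if x = b i then 1 else 0"] by blast
    have "b j \<bullet> adjoint g 1 = (if i = j then 1 else 0)" if "j < m" for j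
      using g \<open>i < m\<close> that inj_onD[OF assms(2), of j i] by (auto simp: adjoint_works)
    then show ?thesis by blast
  qed
  then have "\<forall>i. \<exists>r. i < m \<longrightarrow> (\<forall>j<m. b j \<bullet> r = (if i = j then 1 else 0))" by blast
  from choice[OF this] show ?thesis using that by blast
qed

text \<open>Every nearby point is reached by correcting \<open>\<psi>\<close> along vectors dual to
  the columns of \<open>B\<close>. The correction depends continuously on the point, so the strict
  bounds survive.\<close>

lemma zonotope_interior:
  fixes \<psi> :: "'N::finite \<Rightarrow> real"
  assumes dual: "dual_matrix m M B" and \<psi>: "\<And>k. \<bar>\<psi> k\<bar> < pi / 2"
  shows "(\<lambda>j. \<Sum>k\<in>UNIV. \<psi> k * of_int (B k j)) \<in> Euclidean_space m interior_of zonotope B"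
proof -
  define v where "v j = (\<Sum>k\<in>UNIV. \<psi> k * of_int (B k j))" for j
  obtain \<rho> :: "nat \<Rightarrow> real ^ 'N"
    where \<rho>: "\<And>i j. i < m \<Longrightarrow> j < m \<Longrightarrow> real_column B j \<bullet> \<rho> i = (if i = j then 1 else 0)"
    using dual_basis[OF dual_matrix_independent[OF dual]] by blast
  \<comment> \<open>A continuous choice of coefficients: by duality of \<open>\<rho>\<close>,
    multiplying \<open>\<psi>' y\<close> by \<open>B\<close> returns the first \<open>m\<close>
    coordinates of \<open>y\<close>. At \<open>y = v\<close> it is \<open>\<psi>\<close>
    itself.\<close>
  define \<psi>' where "\<psi>' y k = \<psi> k + (\<Sum>i<m. (y i - v i) * \<rho> i $ k)" for y k
  define T where "T = topspace (Euclidean_space m) \<inter> {y. \<forall>k. \<bar>\<psi>' y k\<bar> < pi / 2}"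
  have B0: "B k j = 0" if "m \<le> j" for k j using dual that by (simp add: dual_matrix_def)
  have "{y. \<forall>k. \<bar>\<psi>' y k\<bar> < pi / 2} = (\<Inter>k. {y. \<bar>\<psi>' y k\<bar> < pi / 2})" by auto
  also have "open \<dots>"
    unfolding \<psi>'_def
    by (intro open_INT ballI finite open_Collect_less continuous_intros continuous_on_product_coordinates)
  finally have "openin (Euclidean_space m) T"
    unfolding T_def Euclidean_space_def euclidean_product_topology topspace_subtopology
    by (auto simp: openin_subtopology intro!: exI[of _ "{y. \<forall>k. \<bar>\<psi>' y k\<bar> < pi / 2}"])
  moreover have "T \<subseteq> zonotope B"
  proof
    fix y assume y: "y \<in> T"
    have "y j = (\<Sum>k\<in>UNIV. \<psi>' y k * of_int (B k j))" for j
    proof (cases "j < m")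
      case True
      have "(\<Sum>k\<in>UNIV. \<psi>' y k * of_int (B k j)) = (\<Sum>k\<in>UNIV. \<psi> k * of_int (B k j)) + (\<Sum>k\<in>UNIV. \<Sum>i<m. (y i - v i) * (of_int (B k j) * \<rho> i $ k))"
        by (simp add: \<psi>'_def distrib_left sum.distrib sum_distrib_left mult_ac)
      also have "\<dots> = v j + (\<Sum>i<m. (y i - v i) * (real_column B j \<bullet> \<rho> i))"
        by (subst sum.swap) (simp add: v_def real_column_def inner_vec_def sum_distrib_left)
      also have "(\<Sum>i<m. (y i - v i) * (real_column B j \<bullet> \<rho> i)) =
          (\<Sum>i<m. if i = j then y i - v i else 0)"
        by (intro sum.cong refl) (simp add: \<rho> True)
      also have "v j + \<dots> = y j" using True by simp
      finally show ?thesis ..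
    next
      case False
      then show ?thesis using y by (simp add: T_def B0 topspace_Euclidean_space)
    qed
    then have "y = (\<lambda>j. \<Sum>k\<in>UNIV. pi / 2 * (2 / pi * \<psi>' y k) * of_int (B k j))" by auto
    moreover have "\<bar>2 / pi * \<psi>' y k\<bar> \<le> 1" for k
    proof -
      have "\<bar>\<psi>' y k\<bar> < pi / 2" using y by (simp add: T_def)
      then show ?thesis by (simp add: abs_mult field_simps)
    qed
    ultimately show "y \<in> zonotope B"
      unfolding zonotope_def by (intro CollectI exI[of _ "\<lambda>k. 2 / pi * \<psi>' y k"] conjI allI)
  qed
  moreover have "v \<in> T"
    using \<psi> by (simp add: T_def \<psi>'_def topspace_Euclidean_space v_def B0)
  ultimately have "v \<in> Euclidean_space m interior_of zonotope B" using interior_of_maximal by blast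
  then show ?thesis by (simp add: v_def[abs_def])
qed

section \<open>Connected components\<close>

text \<open>The cells with the value of \<open>z0\<close> and those with other values have disjoint
  open images covering \<open>\<Theta>\<close>, so connectedness leaves only the former. This also
  shows that the description in \<open>co_ord\<close> has exactly one solution.\<close>

lemma co_ord_eq:
  assumes nz: "\<forall>k. c k \<noteq> 0" and "inj \<alpha>"
    and B: "\<And>j. (\<Sum>k\<in>UNIV. B k j) = 0" "\<And>i j. (\<Sum>k\<in>UNIV. \<alpha> k $ i * B k j) = 0"
    and \<Theta>: "\<Theta> \<in> CC c \<alpha>" and \<theta>0: "to_torus \<theta>0 \<in> \<Theta>" "\<theta>0 \<in> phase_cell c \<alpha> z0"
  shows "co_ord c \<alpha> B \<Theta> =
    (\<lambda>j. row_times (Arg_vec c) B j + 2 * pi * of_int (\<Sum>k\<in>UNIV. z0 k * B k j))"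
proof -
  define w where "w z = (\<lambda>j. \<Sum>k\<in>UNIV. z k * B k j)" for z :: "'a \<Rightarrow> int"
  define P where "P = to_torus ` (\<Union>z\<in>{z. w z = w z0}. phase_cell c \<alpha> z)"
  define Q where "Q = to_torus ` (\<Union>z\<in>{z. w z \<noteq> w z0}. phase_cell c \<alpha> z)"
  have v: "v_vec c \<alpha> B l \<theta> = (\<lambda>j. row_times (Arg_vec c) B j + 2 * pi * of_int (w z j))"
    if "\<theta> \<in> phase_cell c \<alpha> z" for \<theta> z l
    using v_vec_phase_cell[OF nz B(1) that] by (simp add: w_def)
  \<comment> \<open>\<open>B\<close> annihilates the coordinate rows, so \<open>w\<close> does not
    depend on the lift and descends to the torus.\<close>
  have w_shift: "w (\<lambda>k. z k + (\<Sum>i\<in>UNIV. \<alpha> k $ i * x $ i)) = w z" for z and x :: "int ^ 'b"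
  proof
    fix j
    have "(\<Sum>k\<in>UNIV. \<Sum>i\<in>UNIV. \<alpha> k $ i * x $ i * B k j) =
        (\<Sum>i\<in>UNIV. x $ i * (\<Sum>k\<in>UNIV. \<alpha> k $ i * B k j))"
      by (subst sum.swap) (simp add: sum_distrib_left mult_ac)
    then show "w (\<lambda>k. z k + (\<Sum>i\<in>UNIV. \<alpha> k $ i * x $ i)) j = w z j"
      by (simp add: w_def distrib_right sum.distrib sum_distrib_right B(2))
  qed
  have w_unique: "w z = w z'" if *: "\<theta> \<in> phase_cell c \<alpha> z" "\<theta>' \<in> phase_cell c \<alpha> z'"
    "to_torus \<theta> = to_torus \<theta>'" for \<theta> \<theta>' z z'
  proof -
    obtain x where "\<theta> \<in> phase_cell c \<alpha> (\<lambda>k. z' k + (\<Sum>i\<in>UNIV. \<alpha> k $ i * x $ i))"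
      using phase_cell_to_torus[OF *(3,2)] .
    \<comment> \<open>Both cells contain \<open>\<theta>\<close> and so prescribe the same value
      there; \<open>undefined\<close> merely fills in an arbitrary base index.\<close>
    from v[OF *(1), of undefined] v[OF this, of undefined] show ?thesis
      by (simp add: w_shift fun_eq_iff)
  qed
  have "open P" "open Q"
    unfolding P_def Q_def by (intro open_image_to_torus open_UN ballI open_phase_cell)+
  moreover have "P \<inter> Q \<inter> \<Theta> = {}" 
  proof -
    have False if t: "t \<in> P" "t \<in> Q" for t
    proof -
      obtain \<theta> z where "t = to_torus \<theta>" "\<theta> \<in> phase_cell c \<alpha> z" "w z = w z0"
        using t(1) by (auto simp: P_def)
      moreover obtain \<theta>' z' where "t = to_torus \<theta>'" "\<theta>' \<in> phase_cell c \<alpha> z'" "w z' \<noteq> w z0"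
        using t(2) by (auto simp: Q_def)
      ultimately show False using w_unique[of \<theta> z \<theta>' z'] by simp
    qed
    then show ?thesis by blast
  qed
  moreover have "\<Theta> \<subseteq> P \<union> Q"
  proof -
    have "\<Theta> \<subseteq> to_torus ` (\<Union>z. phase_cell c \<alpha> z)"
      using in_components_subset[OF \<Theta>[unfolded CC_def]]
        compl_closure_lopsided_coamoeba[OF \<open>inj \<alpha>\<close>, of c] by simp
    also have "(\<Union>z. phase_cell c \<alpha> z) = (\<Union>z\<in>{z. w z = w z0}. phase_cell c \<alpha> z) \<union>
        (\<Union>z\<in>{z. w z \<noteq> w z0}. phase_cell c \<alpha> z)"
      by blast
    finally show ?thesis by (simp only: P_def Q_def image_Un)
  qed
  moreover have "connected \<Theta>" using \<Theta> in_components_connected unfolding CC_def by blast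
  moreover have "P \<inter> \<Theta> \<noteq> {}" using \<theta>0 by (auto simp: P_def)
  ultimately have "Q \<inter> \<Theta> = {}" using connectedD[of \<Theta> P Q] by blast
  then have \<Theta>P: "\<Theta> \<subseteq> P" using \<open>\<Theta> \<subseteq> P \<union> Q\<close> by blast
  have "v_vec c \<alpha> B l \<theta> = v_vec c \<alpha> B l' \<theta>0" if \<theta>: "to_torus \<theta> \<in> \<Theta>" for \<theta> l l'
  proof -
    obtain \<theta>' z where z: "\<theta>' \<in> phase_cell c \<alpha> z" "w z = w z0" "to_torus \<theta> = to_torus \<theta>'"
      using \<Theta>P \<theta> by (auto simp: P_def)
    obtain x where "\<theta> \<in> phase_cell c \<alpha> (\<lambda>k. z k + (\<Sum>i\<in>UNIV. \<alpha> k $ i * x $ i))"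
      using phase_cell_to_torus[OF z(3,1)] .
    then show ?thesis by (simp add: v v[OF \<theta>0(2)] w_shift z(2))
  qed
  then have "co_ord c \<alpha> B \<Theta> = v_vec c \<alpha> B undefined \<theta>0"
    unfolding co_ord_def using \<theta>0(1) by (intro the_equality) (blast, metis)
  then show ?thesis using v[OF \<theta>0(2)] by (simp add: w_def)
qed

lemma CC_phase_cell:
  assumes "inj \<alpha>" "\<Theta> \<in> CC c \<alpha>"
  obtains \<theta> z where "to_torus \<theta> \<in> \<Theta>" "\<theta> \<in> phase_cell c \<alpha> z"
proof -
  obtain t where "t \<in> \<Theta>" using assms(2) in_components_nonempty unfolding CC_def by blast
  moreover have "\<Theta> \<subseteq> to_torus ` (\<Union>z. phase_cell c \<alpha> z)"
    using in_components_subset[OF assms(2)[unfolded CC_def]]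
      compl_closure_lopsided_coamoeba[OF assms(1), of c] by simp
  ultimately show ?thesis using that by blast
qed

section \<open>Values of the order map and its injectivity\<close>

theorem proposition4p7:
  fixes c :: "'N::finite \<Rightarrow> complex"
    and \<alpha> :: "'N \<Rightarrow> int ^ 'n::finite"
    and B :: "'N \<Rightarrow> nat \<Rightarrow> int"
    and m :: nat
  assumes "\<forall>k. c k \<noteq> 0"
    and "inj \<alpha>"
    and "aff_dim (newton_polytope \<alpha>) = int CARD('n)"
    and "m = CARD('N) - CARD('n) - 1"
    and "dual_matrix m (exponent_matrix \<alpha>) B"
    and "gcd_maximal_minors (exponent_matrix \<alpha>) = 1"
  shows "co_ord c \<alpha> B \<in> CC c \<alpha> \<rightarrow> co_ord_target m c B \<and> inj_on (co_ord c \<alpha> B) (CC c \<alpha>)"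
proof
  note B = dual_matrix_exponent_matrix[OF assms(5)]
  note co_ord = co_ord_eq[where B = B, OF assms(1,2) B]
  show "co_ord c \<alpha> B \<in> CC c \<alpha> \<rightarrow> co_ord_target m c B"
  proof
    fix \<Theta> assume \<Theta>: "\<Theta> \<in> CC c \<alpha>"
    obtain \<theta> z where \<theta>: "to_torus \<theta> \<in> \<Theta>" "\<theta> \<in> phase_cell c \<alpha> z"
      using CC_phase_cell[OF assms(2) \<Theta>] .
    obtain \<phi> where \<phi>: "\<And>k. \<bar>Arg (c k) + real_vec (\<alpha> k) \<bullet> \<theta> + 2 * pi * of_int (z k) - \<phi>\<bar> < pi / 2"
      using \<theta>(2) by (auto simp: phase_cell_def)
    \<comment> \<open>The centred phases differ from \<open>Arg (c k) + 2 * pi * z k\<close> by a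
      combination of rows of the exponent matrix, which \<open>B\<close> annihilates. They are
      smaller than \<open>pi / 2\<close> in absolute value, so the order is an interior point of the
      zonotope.\<close>
    have "(\<Sum>k\<in>UNIV. (Arg (c k) + real_vec (\<alpha> k) \<bullet> \<theta> + 2 * pi * of_int (z k) - \<phi>) * of_int (B k j)) =
        row_times (Arg_vec c) B j + 2 * pi * of_int (\<Sum>k\<in>UNIV. z k * B k j)" for j
    proof -
      have "(\<Sum>k\<in>UNIV. real_vec (\<alpha> k) \<bullet> \<theta> * of_int (B k j)) =
          (\<Sum>k\<in>UNIV. \<Sum>i\<in>UNIV. \<theta> $ i * of_int (\<alpha> k $ i * B k j))"
        by (simp add: real_vec_def inner_vec_def sum_distrib_left mult_ac)
      also have "\<dots> = (\<Sum>i\<in>UNIV. \<theta> $ i * of_int (\<Sum>k\<in>UNIV. \<alpha> k $ i * B k j))"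
        by (subst sum.swap) (simp add: sum_distrib_left)
      also have "\<dots> = 0" by (simp add: B(2) del: of_int_sum)
      finally have \<alpha>: "(\<Sum>k\<in>UNIV. real_vec (\<alpha> k) \<bullet> \<theta> * of_int (B k j)) = 0" .
      have "(\<Sum>k\<in>UNIV. \<phi> * of_int (B k j)) = \<phi> * of_int (\<Sum>k\<in>UNIV. B k j)"
        by (simp add: sum_distrib_left)
      also have "\<dots> = 0" by (simp add: B(1) del: of_int_sum)
      finally have \<phi>: "(\<Sum>k\<in>UNIV. \<phi> * of_int (B k j)) = 0" .
      show ?thesis
        by (simp add: distrib_right left_diff_distrib sum.distrib sum_subtractf \<alpha> \<phi>)
          (simp add: row_times_def Arg_vec_def sum_distrib_left mult_ac)
    qed
    then have "(\<lambda>j. row_times (Arg_vec c) B j + 2 * pi * of_int (\<Sum>k\<in>UNIV. z k * B k j))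
        \<in> Euclidean_space m interior_of zonotope B"
      using zonotope_interior[where \<psi> = "\<lambda>k. Arg (c k) + real_vec (\<alpha> k) \<bullet> \<theta> + 2 * pi * of_int (z k) - \<phi>",
          OF assms(5) \<phi>] by simp
    then show "co_ord c \<alpha> B \<Theta> \<in> co_ord_target m c B"
      unfolding co_ord[OF \<Theta> \<theta>] co_ord_target_def row_lattice_def
      by (intro IntI CollectI exI[of _ "\<lambda>j. \<Sum>k\<in>UNIV. z k * B k j"] exI[of _ z] conjI refl TrueI)
  qed
  show "inj_on (co_ord c \<alpha> B) (CC c \<alpha>)"
  proof (rule inj_onI)
    fix \<Theta> \<Theta>' assume \<Theta>: "\<Theta> \<in> CC c \<alpha>" and \<Theta>': "\<Theta>' \<in> CC c \<alpha>"
      and eq: "co_ord c \<alpha> B \<Theta> = co_ord c \<alpha> B \<Theta>'"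
    obtain \<theta> z where \<theta>: "to_torus \<theta> \<in> \<Theta>" "\<theta> \<in> phase_cell c \<alpha> z"
      using CC_phase_cell[OF assms(2) \<Theta>] .
    obtain \<theta>' z' where \<theta>': "to_torus \<theta>' \<in> \<Theta>'" "\<theta>' \<in> phase_cell c \<alpha> z'"
      using CC_phase_cell[OF assms(2) \<Theta>'] .
    have "(\<Sum>k\<in>UNIV. z' k * B k j) = (\<Sum>k\<in>UNIV. z k * B k j)" for j
      using fun_cong[OF eq[unfolded co_ord[OF \<Theta> \<theta>] co_ord[OF \<Theta>' \<theta>']], of j]
      by (simp del: of_int_sum)
    then have "(\<Sum>k\<in>UNIV. (z' k - z k) * B k j) = 0" for j
      by (simp add: left_diff_distrib sum_subtractf)
    \<comment> \<open>The type \<open>'n option\<close> counts the row of ones along with the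
      coordinates, hence the extra 1 subtracted in \<open>m\<close>.\<close>
    moreover have "m = CARD('N) - CARD('n option)" using assms(4) by simp
    ultimately obtain y where y: "\<And>k. z' k - z k = (\<Sum>r\<in>UNIV. y r * exponent_matrix \<alpha> $ r $ k)"
      using left_kernel_dual_matrix[OF assms(6,5), where z = "\<lambda>k. z' k - z k"] by blast
    \<comment> \<open>The coefficients of the coordinate rows give the translation by a period; that
      of the row of ones is the constant \<open>a\<close> of
      \<open>phase_cell_shift\<close>.\<close>
    define x where "x = (\<chi> i. y (Some i))"
    have "z' k = z k + (y None + (\<Sum>i\<in>UNIV. \<alpha> k $ i * x $ i))" for k
    proof -
      have "(\<Sum>r\<in>UNIV. y r * exponent_matrix \<alpha> $ r $ k) = y None + (\<Sum>i\<in>UNIV. y (Some i) * \<alpha> k $ i)"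
        by (simp add: UNIV_option_conv sum.insert sum.reindex exponent_matrix_def)
      then show ?thesis using y[of k] by (simp add: x_def mult.commute)
    qed
    then have "z' = (\<lambda>k. z k + (y None + (\<Sum>i\<in>UNIV. \<alpha> k $ i * x $ i)))" by blast
    then have "\<theta>' + (2 * pi) *\<^sub>R real_vec x \<in> phase_cell c \<alpha> z"
      using \<theta>'(2) phase_cell_shift by blast
    moreover have "to_torus (\<theta>' + (2 * pi) *\<^sub>R real_vec x) = to_torus \<theta>'"
      using to_torus_eq_iff by blast
    ultimately have \<theta>'_cell: "to_torus \<theta>' \<in> to_torus ` phase_cell c \<alpha> z" by (metis image_eqI)
    have \<theta>_cell: "to_torus \<theta> \<in> to_torus ` phase_cell c \<alpha> z" using \<theta>(2) by (rule imageI)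
    \<comment> \<open>The image of this one cell is connected, avoids the closed coamoeba and meets
      both components, so by maximality it lies inside \<open>\<Theta>'\<close>, which then meets
      \<open>\<Theta>\<close>.\<close>
    have "connected (to_torus ` phase_cell c \<alpha> z)"
      by (intro connected_continuous_image continuous_to_torus convex_connected convex_phase_cell)
    moreover have "to_torus ` phase_cell c \<alpha> z \<subseteq> - closure (lopsided_coamoeba c \<alpha>)"
      unfolding compl_closure_lopsided_coamoeba[OF assms(2)] by blast
    ultimately have "to_torus ` phase_cell c \<alpha> z \<subseteq> \<Theta>'"
      using \<theta>'(1) \<theta>'_cell by (intro components_maximal[OF \<Theta>'[unfolded CC_def]]) (simp_all, blast)
    then have "to_torus \<theta> \<in> \<Theta>'" using \<theta>_cell by (rule subsetD)
    then have "\<Theta> \<inter> \<Theta>' \<noteq> {}" using \<theta>(1) by blast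
    then show "\<Theta> = \<Theta>'"
      using components_eq[OF \<Theta>[unfolded CC_def] \<Theta>'[unfolded CC_def]] by blast
  qed
qed

end
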